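(* Every finite group $G$ satisfying $\mathcal{CD}(G)=[G/Z(G)]$ is nilpotent.
   Context: For a finite group $G$, $L(G)$ denotes the lattice of all subgroups of $G$ and $Z(G)$ its center. The Chermak-Delgado measure of a subgroup $H\le G$ is $m_G(H)=|H|\,|C_G(H)|$, where $C_G(H)$ is the centralizer of $H$ in $G$. Put $m(G)=\max\{m_G(H)\mid H\le G\}$ and $\mathcal{CD}(G)=\{H\le G\mid m_G(H)=m(G)\}$ (the Chermak-Delgado lattice of $G$). The interval $[G/Z(G)]$ is $\{H\in L(G)\mid Z(G)\le H\le G\}$. *)

theory Defs
  imports "HOL-Algebra.Coset"
begin

definition subgroup_lattice :: "('a, 'b) monoid_scheme \<Rightarrow> 'a set set" where
  "subgroup_lattice G = {H. subgroup H G}"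

definition centralizer :: "('a, 'b) monoid_scheme \<Rightarrow> 'a set \<Rightarrow> 'a set" where
  "centralizer G H = {g \<in> carrier G. \<forall>h\<in>H. g \<otimes>\<^bsub>G\<^esub> h = h \<otimes>\<^bsub>G\<^esub> g}"

definition group_center :: "('a, 'b) monoid_scheme \<Rightarrow> 'a set" where
  "group_center G = {z \<in> carrier G. \<forall>g\<in>carrier G. z \<otimes>\<^bsub>G\<^esub> g = g \<otimes>\<^bsub>G\<^esub> z}"

definition cd_measure :: "('a, 'b) monoid_scheme \<Rightarrow> 'a set \<Rightarrow> nat" where
  "cd_measure G H = card H * card (centralizer G H)"

text \<open>Meaningful for finite \<open>G\<close> only: \<open>card\<close> is \<open>0\<close> and \<open>Max\<close> is unspecified
  on infinite sets.\<close>

definition max_cd_measure :: "('a, 'b) monoid_scheme \<Rightarrow> nat" where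
  "max_cd_measure G = Max (cd_measure G ` subgroup_lattice G)"

definition cd_lattice :: "('a, 'b) monoid_scheme \<Rightarrow> 'a set set" where
  "cd_lattice G = {H \<in> subgroup_lattice G. cd_measure G H = max_cd_measure G}"

definition center_interval :: "('a, 'b) monoid_scheme \<Rightarrow> 'a set set" where
  "center_interval G = {H \<in> subgroup_lattice G. group_center G \<subseteq> H \<and> H \<subseteq> carrier G}"

text \<open>Existence of a finite central series
  \<open>1 = N\<^sub>0 \<subseteq> N\<^sub>1 \<subseteq> \<dots> \<subseteq> N\<^sub>n = G\<close> of normal subgroups with
  \<open>N\<^sub>i\<^sub>+\<^sub>1 / N\<^sub>i\<close> contained in the center of \<open>G / N\<^sub>i\<close>.\<close>

definition nilpotent_group :: "('a, 'b) monoid_scheme \<Rightarrow> bool" where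
  "nilpotent_group G \<longleftrightarrow>
    (\<exists>(n::nat) N. N 0 = {\<one>\<^bsub>G\<^esub>} \<and> N n = carrier G \<and>
      (\<forall>i\<le>n. N i \<lhd> G) \<and>
      (\<forall>i<n. N i \<subseteq> N (Suc i) \<and>
        carrier (G\<lparr>carrier := N (Suc i)\<rparr> Mod N i) \<subseteq> group_center (G Mod N i)))"

end

theory Submission
  imports Defs "HOL-Algebra.Group_Action" "HOL-Algebra.SndIsomorphismGrp" "HOL-Algebra.Sylow"
begin

text \<open>Write \<open>Z\<close> for the center of \<open>G\<close> and \<open>C(A)\<close> for the centralizer of \<open>A\<close>.

  If the Chermak-Delgado lattice is the whole interval above \<open>Z\<close>, then in particular \<open>G\<close> itself
  attains the maximal measure, so \<open>|H| |C(H)| = |G| |Z|\<close> for every subgroup \<open>H\<close> containing \<open>Z\<close>.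
  For an arbitrary subgroup \<open>A\<close> this applies to \<open>ZA\<close>, which has the same centralizer as \<open>A\<close>;
  since \<open>|ZA| |Z \<inter> A| = |Z| |A|\<close>, the result is \<open>|A| |C(A)| = |G| |Z \<inter> A|\<close>
  (lemma \<open>card_mult_centralizer_if_cd_eq_center_interval\<close>).

  Let \<open>A = P\<close> be a Sylow \<open>p\<close>-subgroup. The formula shows that the index of \<open>C(P)\<close> is a power
  of \<open>p\<close>, while the index of \<open>P\<close> is prime to \<open>p\<close>. The subgroup \<open>C(P)P\<close> therefore has index one:
  \<open>G = C(P)P\<close> (lemma \<open>centralizer_mult_sylow\<close>).

  Such factorizations, one for each prime, force \<open>G\<close> to be nilpotent
  (theorem \<open>nilpotent_if_centralizer_mult_sylow\<close>), because every quotient \<open>G/N \<noteq> 1\<close> has a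
  nontrivial center. For a prime \<open>p\<close> dividing the index of \<open>N\<close>, the \<open>p\<close>-group \<open>P / (N \<inter> P)\<close> is
  nontrivial, so it has a central element other than the identity, represented by some \<open>x \<in> P\<close>
  outside \<open>N\<close>. Modulo \<open>N\<close>, this \<open>x\<close> commutes with \<open>P\<close>, and it commutes with \<open>C(P)\<close>, hence with
  all of \<open>G = C(P)P\<close>. The upper central series of the finite group \<open>G\<close> thus grows until it reaches
  \<open>G\<close>.\<close>

section \<open>Centralizers, centers and products of subgroups\<close>

lemma (in group) centralizer_subgroup:
  assumes "H \<subseteq> carrier G"
  shows "subgroup (centralizer G H) G"
proof (rule subgroupI)
  show "centralizer G H \<subseteq> carrier G" "centralizer G H \<noteq> {}"
    using assms by (auto simp: centralizer_def intro!: exI[of _ \<one>])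
next
  fix a assume a: "a \<in> centralizer G H"
  have "inv a \<otimes> h = h \<otimes> inv a" if h: "h \<in> H" for h
  proof -
    have mem: "a \<in> carrier G" "h \<in> carrier G" and comm: "a \<otimes> h = h \<otimes> a"
      using a h assms by (auto simp: centralizer_def)
    have "inv a \<otimes> h = inv a \<otimes> (h \<otimes> a) \<otimes> inv a"
      using mem by (simp add: m_assoc)
    also have "\<dots> = h \<otimes> inv a"
      using mem by (simp add: comm[symmetric] inv_solve_left' m_assoc[symmetric])
    finally show ?thesis .
  qed
  then show "inv a \<in> centralizer G H" using a by (simp add: centralizer_def)
next
  fix a b assume a: "a \<in> centralizer G H" and b: "b \<in> centralizer G H"
  have "a \<otimes> b \<otimes> h = h \<otimes> (a \<otimes> b)" if h: "h \<in> H" for h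
  proof -
    have mem: "a \<in> carrier G" "b \<in> carrier G" "h \<in> carrier G"
      and comm: "a \<otimes> h = h \<otimes> a" "b \<otimes> h = h \<otimes> b"
      using a b h assms by (auto simp: centralizer_def)
    have "a \<otimes> b \<otimes> h = a \<otimes> h \<otimes> b" using mem by (simp add: m_assoc comm(2))
    then show ?thesis using mem by (simp add: comm(1) m_assoc)
  qed
  then show "a \<otimes> b \<in> centralizer G H" using a b by (simp add: centralizer_def)
qed

lemma group_center_eq_centralizer: "group_center G = centralizer G (carrier G)"
  by (simp add: group_center_def centralizer_def)

lemma (in group) center_normal: "group_center G \<lhd> G"
proof (rule normal_invI)
  show "subgroup (group_center G) G"
    by (simp add: group_center_eq_centralizer centralizer_subgroup)
  fix x h assume x: "x \<in> carrier G" and h: "h \<in> group_center G"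
  have "x \<otimes> h = h \<otimes> x" "h \<in> carrier G"
    using x h by (auto simp: group_center_def)
  then have "x \<otimes> h \<otimes> inv x = h" using x by (simp add: m_assoc)
  then show "x \<otimes> h \<otimes> inv x \<in> group_center G" using h by simp
qed

lemma (in group) subgroup_mult_commuting:
  assumes A: "subgroup A G" and B: "subgroup B G"
    and comm: "\<And>a b. a \<in> A \<Longrightarrow> b \<in> B \<Longrightarrow> a \<otimes> b = b \<otimes> a"
  shows "subgroup (A <#> B) G"
proof (rule subgroupI)
  show "A <#> B \<subseteq> carrier G"
    using A B by (simp add: set_mult_closed subgroup.subset)
  show "A <#> B \<noteq> {}"
    using subgroup.one_closed[OF A] subgroup.one_closed[OF B] by (auto simp: set_mult_def)
next
  fix x assume "x \<in> A <#> B"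
  then obtain a b where x: "x = a \<otimes> b" and ab: "a \<in> A" "b \<in> B" by (auto simp: set_mult_def)
  have "inv x = inv (b \<otimes> a)" using x comm[OF ab] by simp
  also have "\<dots> = inv a \<otimes> inv b"
    using ab A B by (simp add: inv_mult_group subgroup.mem_carrier)
  finally show "inv x \<in> A <#> B"
    using ab A B by (auto simp: set_mult_def dest: subgroup.m_inv_closed)
next
  fix x y assume "x \<in> A <#> B" "y \<in> A <#> B"
  then obtain a b a' b' where x: "x = a \<otimes> b" "a \<in> A" "b \<in> B"
    and y: "y = a' \<otimes> b'" "a' \<in> A" "b' \<in> B" by (auto simp: set_mult_def)
  have mem: "a \<in> carrier G" "b \<in> carrier G" "a' \<in> carrier G" "b' \<in> carrier G"
    using x y A B by (auto dest: subgroup.mem_carrier)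
  have "x \<otimes> y = a \<otimes> (b \<otimes> a') \<otimes> b'" using mem by (simp add: x y m_assoc)
  also have "\<dots> = (a \<otimes> a') \<otimes> (b \<otimes> b')"
    using mem by (simp add: comm[OF y(2) x(3), symmetric] m_assoc)
  finally show "x \<otimes> y \<in> A <#> B"
    using x y A B by (auto simp: set_mult_def dest: subgroup.m_closed)
qed

lemma (in group) card_subgroup_dvd:
  assumes "subgroup H G" "subgroup K G" "H \<subseteq> K"
  shows "card H dvd card K"
proof -
  have "subgroup H (G\<lparr>carrier := K\<rparr>)"
    using assms by (simp add: subgroup_incl)
  then have "card (rcosets\<^bsub>G\<lparr>carrier := K\<rparr>\<^esub> H) * card H = card K"
    using group.lagrange[OF subgroup_imp_group[OF assms(2)]] by (simp add: order_def)
  then show ?thesis by (metis dvd_triv_right)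
qed

text \<open>By the second isomorphism theorem, \<open>N\<close> has the same index in \<open>NS\<close> as \<open>N \<inter> S\<close> has in \<open>S\<close>;
  clearing denominators gives a form without quotients.\<close>

lemma (in group) card_mult_normal:
  assumes N: "N \<lhd> G" and S: "subgroup S G"
  shows "card (N <#> S) * card (N \<inter> S) = card N * card S"
proof -
  interpret second_isomorphism_grp N G S
    using N S by (simp add: second_isomorphism_grp_def second_isomorphism_grp_axioms_def)
  have T: "subgroup (N <#> S) G" by (rule normal_set_mult_subgroup)
  have sub1: "subgroup N (G\<lparr>carrier := N <#> S\<rparr>)"
    using subgroup_incl[OF subgroup_axioms T H_contained_in_set_mult] .
  have sub2: "subgroup (N \<inter> S) (G\<lparr>carrier := S\<rparr>)"
    using subgroup_incl[OF subgroups_Inter_pair[OF subgroup_axioms S] S] by simp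
  have cosets: "card (rcosets\<^bsub>G\<lparr>carrier := S\<rparr>\<^esub> (N \<inter> S)) = card (rcosets\<^bsub>G\<lparr>carrier := N <#> S\<rparr>\<^esub> N)"
    using iso_same_card[OF is_isoI[OF normal_intersection_quotient_isom]]
    by (simp add: FactGroup_def)
  have T_card: "card (rcosets\<^bsub>G\<lparr>carrier := N <#> S\<rparr>\<^esub> N) * card N = card (N <#> S)"
    using group.lagrange[OF subgroup_imp_group[OF T] sub1] by (simp add: order_def)
  have S_card: "card (rcosets\<^bsub>G\<lparr>carrier := S\<rparr>\<^esub> (N \<inter> S)) * card (N \<inter> S) = card S"
    using group.lagrange[OF subgroup_imp_group[OF S] sub2] by (simp add: order_def)
  show ?thesis
    unfolding T_card[symmetric] S_card[symmetric] cosets by (simp only: ac_simps)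
qed

section \<open>Groups of prime power order\<close>

text \<open>The order of an orbit divides \<open>p ^ a\<close>, so every orbit with more than one element has order
  divisible by \<open>p\<close>; the complement of the fixed points is a union of such orbits.\<close>

lemma (in group_action) prime_dvd_card_fixed_points:
  assumes p: "prime (p::nat)" and ord: "order G = p ^ a" and E: "finite E" "p dvd card E"
  shows "p dvd card {x \<in> E. \<forall>g\<in>carrier G. \<phi> g x = x}" (is "p dvd card ?F")
proof -
  \<comment> \<open>The indicator of the moved points: its sum over an orbit is \<open>0\<close> for a fixed point and the
    order of the orbit otherwise.\<close>
  define f :: "'c \<Rightarrow> nat" where "f x = (if x \<in> ?F then 0 else 1)" for x
  have "p dvd (\<Sum>orb\<in>orbits G E \<phi>. \<Sum>x\<in>orb. f x)"
  proof (rule dvd_sum)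
    fix orb assume "orb \<in> orbits G E \<phi>"
    then obtain x where x: "x \<in> E" "orb = orbit G \<phi> x" by (auto simp: orbits_def)
    have sub: "orb \<subseteq> E" using x by (auto simp: orbit_def intro: element_image)
    show "p dvd (\<Sum>x\<in>orb. f x)"
    proof (cases "orb \<inter> ?F = {}")
      case False
      then obtain y where y: "y \<in> orb" "y \<in> ?F" by auto
      then have "x \<in> orbit G \<phi> y" using orbit_sym x by auto
      then have "x = y" using y by (auto simp: orbit_def)
      then have "orb \<subseteq> {y}" using y x by (auto simp: orbit_def)
      then have "(\<Sum>x\<in>orb. f x) = 0" using y(2) by (auto simp: f_def intro!: sum.neutral)
      then show ?thesis by simp
    next
      case True
      have "(\<Sum>x\<in>orb. f x) = (\<Sum>x\<in>orb. 1)"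
        by (rule sum.cong) (use True in \<open>auto simp: f_def\<close>)
      then have s: "(\<Sum>x\<in>orb. f x) = card orb" by simp
      have xo: "x \<in> orb" using x orbit_refl by simp
      have "card orb dvd p ^ a"
        using orbit_stabilizer_theorem[OF x(1)] ord x(2) by (metis dvd_triv_left)
      then obtain b where b: "card orb = p ^ b" using p divides_primepow_nat by blast
      have "b \<noteq> 0"
      proof
        assume "b = 0"
        then have "card orb = 1" using b by simp
        then have one: "orb = {x}" using xo by (metis card_1_singletonE singletonD)
        have "\<phi> g x = x" if "g \<in> carrier G" for g
          using one x(2) that by (auto simp: orbit_def)
        then have "x \<in> ?F" using x by simp
        then show False using True xo by blast
      qed
      then show ?thesis using s b by simp
    qed
  qed
  then have "p dvd (\<Sum>x\<in>E. f x)" unfolding disjoint_sum[OF E(1), of f] .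
  moreover have "(\<Sum>x\<in>E. f x) = card (E - ?F)"
  proof -
    have "(\<Sum>x\<in>E. f x) = (\<Sum>x\<in>E - ?F. 1)"
      by (rule sum.mono_neutral_cong_right) (use E in \<open>auto simp: f_def\<close>)
    then show ?thesis by simp
  qed
  ultimately have moved: "p dvd card (E - ?F)" by simp
  have sub: "?F \<subseteq> E" by blast
  have "card (E - ?F) + card ?F = card E"
    using card_Diff_subset[OF finite_subset[OF sub E(1)] sub] card_mono[OF E(1) sub] by linarith
  then show ?thesis using E(2) dvd_add_right_iff[OF moved, of "card ?F"] by simp
qed

text \<open>The center is the set of fixed points of the conjugation action, so \<open>p\<close> divides its order,
  and the identity cannot be its only element.\<close>

lemma (in group) prime_power_order_center_nontrivial:
  assumes p: "prime (p::nat)" and ord: "order G = p ^ a" and nontriv: "order G \<noteq> 1"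
  shows "\<exists>z\<in>group_center G. z \<noteq> \<one>"
proof -
  interpret conj: group_action G "carrier G" "\<lambda>g. \<lambda>h\<in>carrier G. g \<otimes> h \<otimes> inv g"
    by (rule action_by_conjugation)
  have "order G > 0" using ord p by (simp add: prime_gt_0_nat)
  then have fin: "finite (carrier G)" by (simp add: order_gt_0_iff_finite)
  have "a \<noteq> 0" using ord nontriv by (metis power_0)
  then have "p dvd card (carrier G)" using ord by (simp add: order_def)
  then have "p dvd card {x \<in> carrier G. \<forall>g\<in>carrier G. (\<lambda>h\<in>carrier G. g \<otimes> h \<otimes> inv g) x = x}"
    using conj.prime_dvd_card_fixed_points[OF p ord fin] by simp
  moreover have conj_fixes_iff: "g \<otimes> x \<otimes> inv g = x \<longleftrightarrow> x \<otimes> g = g \<otimes> x"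
    if "x \<in> carrier G" "g \<in> carrier G" for x g
    by (metis inv_solve_right m_closed that)
  moreover have "{x \<in> carrier G. \<forall>g\<in>carrier G. (\<lambda>h\<in>carrier G. g \<otimes> h \<otimes> inv g) x = x} = group_center G"
    using conj_fixes_iff by (auto simp: group_center_def)
  ultimately have "p dvd card (group_center G)" by simp
  then have "group_center G \<noteq> {\<one>}" using p by (auto simp: prime_nat_iff)
  moreover have "\<one> \<in> group_center G"
    using center_normal by (simp add: normal_imp_subgroup subgroup.one_closed)
  ultimately show ?thesis by auto
qed

section \<open>The upper central series\<close>

text \<open>Iterating \<open>center_mod G\<close> from the trivial subgroup produces the upper central series.\<close>

definition center_mod :: "('a, 'b) monoid_scheme \<Rightarrow> 'a set \<Rightarrow> 'a set" where
  "center_mod G N = {x \<in> carrier G. N #>\<^bsub>G\<^esub> x \<in> group_center (G Mod N)}"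

text \<open>This form replaces computations with cosets as elements of the quotient by identities
  between cosets of elements of \<open>G\<close>.\<close>

lemma (in normal) mem_center_mod_iff:
  "x \<in> center_mod G H \<longleftrightarrow>
    x \<in> carrier G \<and> (\<forall>g\<in>carrier G. H #> (x \<otimes> g) = H #> (g \<otimes> x))"
  by (auto simp: center_mod_def group_center_def carrier_FactGroup rcos_sum)

text \<open>It is the preimage of a normal subgroup under the projection to the quotient.\<close>

lemma (in normal) center_mod_normal: "center_mod G H \<lhd> G"
proof -
  interpret Q: group "G Mod H" by (rule factorgroup_is_group)
  interpret hom: group_hom G "G Mod H" "\<lambda>x. H #> x"
    by (simp add: group_hom_def group_hom_axioms_def r_coset_hom_Mod Q.is_group)
  note Z = Q.center_normal
  note ZS = normal_imp_subgroup[OF Z]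
  show ?thesis
  proof (rule normal_invI)
    show "subgroup (center_mod G H) G"
    proof (rule subgroupI)
      show "center_mod G H \<subseteq> carrier G" by (auto simp: center_mod_def)
      show "center_mod G H \<noteq> {}"
        using subgroup.one_closed[OF ZS] hom.hom_one by (auto simp: center_mod_def)
    next
      fix a assume "a \<in> center_mod G H"
      then show "inv a \<in> center_mod G H"
        using subgroup.m_inv_closed[OF ZS, of "H #> a"] hom.hom_inv[of a]
        by (auto simp: center_mod_def)
    next
      fix a b assume "a \<in> center_mod G H" "b \<in> center_mod G H"
      then show "a \<otimes> b \<in> center_mod G H"
        using subgroup.m_closed[OF ZS, of "H #> a" "H #> b"] hom.hom_mult[of a b]
        by (auto simp: center_mod_def)
    qed
    fix x h assume x: "x \<in> carrier G" and "h \<in> center_mod G H"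
    then have h: "h \<in> carrier G" "H #> h \<in> group_center (G Mod H)" by (auto simp: center_mod_def)
    have "H #> (x \<otimes> h \<otimes> inv x) =
        (H #> x) \<otimes>\<^bsub>G Mod H\<^esub> (H #> h) \<otimes>\<^bsub>G Mod H\<^esub> inv\<^bsub>G Mod H\<^esub> (H #> x)"
      using x h hom.hom_mult hom.hom_inv by (metis inv_closed m_closed)
    also have "\<dots> \<in> group_center (G Mod H)"
      using normal.inv_op_closed2[OF Z] hom.hom_closed x h by blast
    finally show "x \<otimes> h \<otimes> inv x \<in> center_mod G H"
      using x h by (simp add: center_mod_def)
  qed
qed

lemma (in normal) subset_center_mod: "H \<subseteq> center_mod G H"
proof
  fix x assume x: "x \<in> H"
  have "H #> (x \<otimes> g) = H #> (g \<otimes> x)" if g: "g \<in> carrier G" for g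
  proof -
    have "H #> (x \<otimes> g) = (H #> x) <#> (H #> g)" "H #> (g \<otimes> x) = (H #> g) <#> (H #> x)"
      using x g by (simp_all add: rcos_sum)
    moreover have "H #> x = H" using x by (simp add: rcos_const is_group)
    ultimately show ?thesis
      using g by (simp add: subset rcosets_mult_eq rcosetsI)
         (metis coset_mult_one one_closed r_one rcos_sum subset)
  qed
  then show "x \<in> center_mod G H" using x by (simp add: mem_center_mod_iff)
qed

text \<open>As long as it has not reached \<open>G\<close>, the upper central series strictly increases, which can
  happen only finitely often in a finite group. The upper central series then witnesses
  nilpotency.\<close>

lemma (in group) nilpotent_if_center_mod_grows:
  assumes fin: "finite (carrier G)"
    and grows: "\<And>N. N \<lhd> G \<Longrightarrow> N \<noteq> carrier G \<Longrightarrow> center_mod G N \<noteq> N"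
  shows "nilpotent_group G"
proof -
  define U where "U i = (center_mod G ^^ i) {\<one>}" for i
  have U0: "U 0 = {\<one>}" and US: "U (Suc i) = center_mod G (U i)" for i
    by (simp_all add: U_def)
  have normal: "U i \<lhd> G" for i
    by (induction i) (simp_all add: U0 US one_is_normal normal.center_mod_normal)
  have mono: "U i \<subseteq> U (Suc i)" for i
    using normal.subset_center_mod[OF normal] by (simp add: US)
  have sub: "U i \<subseteq> carrier G" for i
    using normal by (simp add: normal_imp_subgroup subgroup.subset)
  have "\<exists>n. U n = carrier G"
  proof (rule ccontr)
    assume "\<nexists>n. U n = carrier G"
    then have strict: "U i \<subset> U (Suc i)" for i
      using grows[OF normal] mono US by (metis psubsetI)
    have "i < card (U i)" for i
    proof (induction i)
      case 0
      then show ?case by (simp add: U0)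
    next
      case (Suc i)
      have "card (U i) < card (U (Suc i))"
        using strict sub fin by (meson finite_subset psubset_card_mono)
      then show ?case using Suc by simp
    qed
    moreover have "card (U i) \<le> card (carrier G)" for i
      using sub fin by (simp add: card_mono)
    ultimately show False by (meson leD)
  qed
  then obtain n where "U n = carrier G" ..
  moreover have "carrier (G\<lparr>carrier := U (Suc i)\<rparr> Mod U i) \<subseteq> group_center (G Mod U i)" for i
    by (auto simp: carrier_FactGroup US center_mod_def)
  ultimately show ?thesis
    unfolding nilpotent_group_def
    using U0 normal mono by (intro exI[of _ n] exI[of _ U] conjI allI impI)
qed

section \<open>A nilpotency criterion via Sylow subgroups\<close>

text \<open>The factorization \<open>G = C(P)P\<close> says that conjugation by an element of \<open>G\<close> acts on \<open>P\<close> as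
  conjugation by an element of \<open>P\<close>. An element of \<open>P\<close> that is central in \<open>P\<close> modulo a normal
  subgroup of \<open>G\<close> is therefore central in \<open>G\<close> modulo that subgroup, and the existence of such
  elements is a property of \<open>p\<close>-groups.\<close>

theorem (in group) nilpotent_if_centralizer_mult_sylow:
  assumes fin: "finite (carrier G)"
    and sylow: "\<And>p::nat. prime p \<Longrightarrow> \<exists>P. subgroup P G \<and>
      card P = p ^ multiplicity p (order G) \<and> carrier G = centralizer G P <#> P"
  shows "nilpotent_group G"
proof (rule nilpotent_if_center_mod_grows[OF fin])
  fix N assume N: "N \<lhd> G" and proper: "N \<noteq> carrier G"
  interpret N: normal N G by (rule N)
  have pos: "order G > 0" using fin by (simp add: order_gt_0_iff_finite)
  have idx: "card (rcosets N) * card N = order G" using lagrange[OF N.subgroup_axioms] .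
  have "card (rcosets N) \<noteq> 1"
    using idx proper fin N.subset card_subset_eq by (metis mult_1 order_def)
  then obtain p where p: "prime p" "p dvd card (rcosets N)" using prime_factor_nat by blast
  obtain P where P: "subgroup P G" "card P = p ^ multiplicity p (order G)"
    "carrier G = centralizer G P <#> P" using sylow[OF p(1)] by blast
  define Q where "Q = G\<lparr>carrier := P\<rparr>"
  \<comment> \<open>Otherwise \<open>N\<close> would contain the full \<open>p\<close>-part of the order of \<open>G\<close>, although \<open>p\<close> divides
    its index.\<close>
  have "\<not> P \<subseteq> N"
  proof
    assume "P \<subseteq> N"
    then have "p ^ multiplicity p (order G) dvd card N"
      using card_subgroup_dvd[OF P(1) N.subgroup_axioms] P(2) by simp
    then have "p ^ Suc (multiplicity p (order G)) dvd order G"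
      using mult_dvd_mono[OF p(2)] idx by fastforce
    moreover have "\<not> is_unit p" using p(1) by (simp add: prime_nat_iff)
    ultimately show False
      using pos multiplicity_geI[of "order G" p "Suc (multiplicity p (order G))"] by simp
  qed
  have PG: "P \<subseteq> carrier G" using P(1) by (rule subgroup.subset)
  \<comment> \<open>The quotient \<open>P / (N \<inter> P)\<close> stands in for the image of \<open>P\<close> in \<open>G / N\<close>: its order comes
    directly from Lagrange's theorem.\<close>
  define A where "A = N \<inter> P"
  have A: "A \<lhd> Q" unfolding A_def Q_def by (rule normal_Int_subgroup[OF P(1) N])
  interpret A: normal A Q by (rule A)
  interpret M: group "Q Mod A" by (rule A.factorgroup_is_group)
  have ordM: "order (Q Mod A) * card A = card P"
    using A.lagrange[OF A.subgroup_axioms] by (simp add: FactGroup_def order_def Q_def)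
  then have "order (Q Mod A) dvd p ^ multiplicity p (order G)"
    using P(2) by (metis dvd_triv_left)
  then obtain b where b: "order (Q Mod A) = p ^ b" using divides_primepow_nat[OF p(1)] by blast
  have "order (Q Mod A) \<noteq> 1"
  proof
    assume "order (Q Mod A) = 1"
    then have "card A = card P" using ordM by simp
    then have "A = P"
      using card_subset_eq[OF finite_subset[OF PG fin], of A] by (simp add: A_def)
    then show False using \<open>\<not> P \<subseteq> N\<close> by (auto simp: A_def)
  qed
  then obtain z where z: "z \<in> group_center (Q Mod A)" "z \<noteq> A"
    using M.prime_power_order_center_nontrivial[OF p(1) b] by auto
  then have "z \<in> carrier (Q Mod A)" by (simp add: group_center_def)
  then obtain x where x: "x \<in> P" "z = A #>\<^bsub>Q\<^esub> x" by (auto simp: carrier_FactGroup Q_def)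
  have xN: "x \<notin> N"
    using x z(2) A.rcos_const[OF A.is_group, of x] by (auto simp: A_def)
  have xQ: "x \<in> center_mod Q A" using x z(1) by (simp add: center_mod_def Q_def)
  have commP: "N #> (x \<otimes> y) = N #> (y \<otimes> x)" if y: "y \<in> P" for y
  proof -
    have mem: "x \<otimes> y \<in> P" "y \<otimes> x \<in> P" using x y P(1) by (simp_all add: subgroup.m_closed)
    have "A #> (x \<otimes> y) = A #> (y \<otimes> x)"
      using xQ y by (simp add: A.mem_center_mod_iff) (simp add: Q_def)
    moreover have "x \<otimes> y \<in> A #> (x \<otimes> y)"
      using A.rcos_self[of "x \<otimes> y", OF _ A.subgroup_axioms] mem by (simp add: Q_def)
    ultimately have "x \<otimes> y \<in> N #> (y \<otimes> x)" by (auto simp: r_coset_def A_def)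
    then show ?thesis
      using repr_independence[OF _ _ N.subgroup_axioms] mem PG by blast
  qed
  have "x \<in> center_mod G N"
    unfolding N.mem_center_mod_iff
  proof (intro conjI ballI)
    show xG: "x \<in> carrier G" using x PG by blast
    fix g assume "g \<in> carrier G"
    then obtain c y where g: "g = c \<otimes> y" "c \<in> centralizer G P" "y \<in> P"
      using P(3) by (auto simp: set_mult_def)
    have mem: "c \<in> carrier G" "y \<in> carrier G" and cx: "c \<otimes> x = x \<otimes> c"
      using g x PG by (auto simp: centralizer_def)
    have "N #> (x \<otimes> g) = N #> (c \<otimes> (x \<otimes> y))"
      using mem xG by (simp add: g m_assoc[symmetric] cx)
    also have "\<dots> = (N #> c) <#> (N #> (x \<otimes> y))" using mem xG by (simp add: N.rcos_sum)
    also have "\<dots> = (N #> c) <#> (N #> (y \<otimes> x))" by (simp add: commP[OF g(3)])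
    also have "\<dots> = N #> (g \<otimes> x)" using mem xG by (simp add: N.rcos_sum g m_assoc)
    finally show "N #> (x \<otimes> g) = N #> (g \<otimes> x)" .
  qed
  then show "center_mod G N \<noteq> N" using xN by blast
qed

section \<open>Centralizers when the Chermak-Delgado lattice is the interval above the center\<close>

lemma (in group) centralizer_mult_center:
  assumes "A \<subseteq> carrier G"
  shows "centralizer G (group_center G <#> A) = centralizer G A"
proof
  have "A \<subseteq> group_center G <#> A"
  proof
    fix a assume "a \<in> A"
    moreover have "\<one> \<in> group_center G"
      using center_normal by (simp add: normal_imp_subgroup subgroup.one_closed)
    moreover have "a = \<one> \<otimes> a" using \<open>a \<in> A\<close> assms by auto
    ultimately show "a \<in> group_center G <#> A" unfolding set_mult_def by blast
  qed
  then show "centralizer G (group_center G <#> A) \<subseteq> centralizer G A"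
    by (auto simp: centralizer_def)
  show "centralizer G A \<subseteq> centralizer G (group_center G <#> A)"
  proof
    fix g assume g: "g \<in> centralizer G A"
    have "g \<otimes> (z \<otimes> a) = z \<otimes> a \<otimes> g" if "z \<in> group_center G" "a \<in> A" for z a
    proof -
      have mem: "g \<in> carrier G" "z \<in> carrier G" "a \<in> carrier G"
        and comm: "z \<otimes> g = g \<otimes> z" "g \<otimes> a = a \<otimes> g"
        using g that assms by (auto simp: centralizer_def group_center_def)
      have "g \<otimes> (z \<otimes> a) = z \<otimes> (g \<otimes> a)"
        using mem by (simp add: m_assoc[symmetric] comm(1))
      then show ?thesis using mem by (simp add: comm(2) m_assoc)
    qed
    then show "g \<in> centralizer G (group_center G <#> A)"
      using g by (auto simp: centralizer_def set_mult_def)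
  qed
qed

text \<open>The hypothesis speaks only of subgroups above the center. It reaches an arbitrary subgroup
  \<open>A\<close> through its product with the center, at the price of the factor \<open>|Z \<inter> A|\<close>.\<close>

lemma (in group) card_mult_centralizer_if_cd_eq_center_interval:
  assumes fin: "finite (carrier G)" and cd: "cd_lattice G = center_interval G"
    and A: "subgroup A G"
  shows "card A * card (centralizer G A) = order G * card (group_center G \<inter> A)"
proof -
  let ?Z = "group_center G"
  have Z: "subgroup ?Z G" using center_normal by (rule normal_imp_subgroup)
  interpret second_isomorphism_grp ?Z G A
    using center_normal A by (simp add: second_isomorphism_grp_def second_isomorphism_grp_axioms_def)
  have measure: "cd_measure G H = max_cd_measure G" if "subgroup H G" "?Z \<subseteq> H" for H
  proof -
    have "H \<in> center_interval G"
      using that by (simp add: center_interval_def subgroup_lattice_def subgroup.subset)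
    then show ?thesis using cd by (auto simp: cd_lattice_def)
  qed
  have "cd_measure G (?Z <#> A) = cd_measure G (carrier G)"
    using measure[OF normal_set_mult_subgroup H_contained_in_set_mult]
      measure[OF subgroup_self subset] by simp
  then have 1: "card (?Z <#> A) * card (centralizer G A) = order G * card ?Z"
    using A by (simp add: cd_measure_def centralizer_mult_center subgroup.subset
        group_center_eq_centralizer[symmetric] order_def)
  have 2: "card (?Z <#> A) * card (?Z \<inter> A) = card ?Z * card A"
    by (rule card_mult_normal[OF center_normal A])
  have "card ?Z * (card A * card (centralizer G A))
      = (card (?Z <#> A) * card (centralizer G A)) * card (?Z \<inter> A)"
    using 2 by (simp add: ac_simps)
  also have "\<dots> = card ?Z * (order G * card (?Z \<inter> A))" using 1 by (simp add: ac_simps)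
  finally show ?thesis
    using subgroup.finite_imp_card_positive[OF Z fin] by simp
qed

text \<open>Both the \<open>p\<close>-part of \<open>|G|\<close> (through \<open>P\<close>) and the complementary part \<open>m\<close> (through \<open>C(P)\<close>, by the
  preceding formula) divide the order of the subgroup \<open>C(P)P\<close>.\<close>

lemma (in group) centralizer_mult_sylow:
  assumes fin: "finite (carrier G)" and cd: "cd_lattice G = center_interval G"
    and p: "prime p" and P: "subgroup P G" "card P = p ^ multiplicity p (order G)"
  shows "carrier G = centralizer G P <#> P"
proof -
  let ?C = "centralizer G P" and ?q = "p ^ multiplicity p (order G)"
  have pos: "order G > 0" using fin by (simp add: order_gt_0_iff_finite)
  have PG: "P \<subseteq> carrier G" using P(1) by (rule subgroup.subset)
  have C: "subgroup ?C G" using PG by (rule centralizer_subgroup)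
  have T: "subgroup (?C <#> P) G"
    using C P(1) by (rule subgroup_mult_commuting) (simp add: centralizer_def)
  have "?C \<subseteq> ?C <#> P"
  proof
    fix c assume "c \<in> ?C"
    moreover from this have "c = c \<otimes> \<one>" using subgroup.mem_carrier[OF C] by simp
    ultimately show "c \<in> ?C <#> P"
      using subgroup.one_closed[OF P(1)] unfolding set_mult_def by blast
  qed
  then have C_dvd: "card ?C dvd card (?C <#> P)" by (rule card_subgroup_dvd[OF C T])
  have "P \<subseteq> ?C <#> P"
  proof
    fix x assume "x \<in> P"
    moreover from this have "x = \<one> \<otimes> x" using PG by auto
    ultimately show "x \<in> ?C <#> P"
      using subgroup.one_closed[OF C] unfolding set_mult_def by blast
  qed
  then have P_dvd: "?q dvd card (?C <#> P)" using card_subgroup_dvd[OF P(1) T] P(2) by simp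
  obtain m where m: "order G = ?q * m" "\<not> p dvd m"
    using multiplicity_decompose'[of "order G" p] pos p by (auto simp: prime_nat_iff)
  have "?q * card ?C = ?q * (m * card (group_center G \<inter> P))"
    using card_mult_centralizer_if_cd_eq_center_interval[OF fin cd P(1)] P(2) m(1)
    by (simp add: mult.assoc)
  then have "card ?C = m * card (group_center G \<inter> P)" using p by (auto simp: prime_gt_0_nat)
  then have "m dvd card (?C <#> P)" using C_dvd by (metis dvd_trans dvd_triv_left)
  moreover have "coprime ?q m" using p m(2) by (simp add: prime_imp_coprime)
  ultimately have "order G dvd card (?C <#> P)" using P_dvd m(1) by (metis divides_mult)
  moreover have "?C <#> P \<subseteq> carrier G" using T by (rule subgroup.subset)
  ultimately show ?thesis
    using fin subgroup.finite_imp_card_positive[OF T fin]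
    by (metis card_mono card_subset_eq dvd_imp_le le_antisym order_def)
qed

theorem corollary2:
  fixes G (structure)
  assumes "group G" and "finite (carrier G)"
    and "cd_lattice G = center_interval G"
  shows "nilpotent_group G"
proof -
  interpret group G by (rule assms(1))
  show ?thesis
  proof (rule nilpotent_if_centralizer_mult_sylow[OF assms(2)])
    fix p :: nat assume p: "prime p"
    have "\<exists>m. order G = p ^ multiplicity p (order G) * m"
      using multiplicity_dvd[of p "order G"] by (auto elim: dvdE)
    then obtain P where "subgroup P G" "card P = p ^ multiplicity p (order G)"
      using sylow_thm[OF p is_group _ assms(2)] by blast
    then show "\<exists>P. subgroup P G \<and> card P = p ^ multiplicity p (order G) \<and>
        carrier G = centralizer G P <#> P"
      using centralizer_mult_sylow[OF assms(2,3) p] by blast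
  qed
qed

end
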